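(* Let $R,B,a\ge 1$ be integers. Consider a deck with $R$ red cards on top of $B$ black cards (cards of the same color being indistinguishable). For any configuration $w$ of $R$ red and $B$ black cards, the probability $Q_a(w)$ that an $a$-shuffle results in the configuration $w$ is $$Q_a(w)=\frac{1}{a^{R+B}}\sum_{k=1}^{a}\sum_{j=1}^{R}(k-1)^{R-j}\,k^{j-1}\,(a-k)^{b(j)}\,(a-k+1)^{B-b(j)},$$ where $b(j)=b_w(j)$ is the number of black cards above the $j$th red card (counted from the top) in the deck $w$.
   Context: The convention $0^0=1$ is used. $a$-shuffle of $n$ cards: the deck is cut into $a$ consecutive packets of sizes $A_1,\dots,A_a\ge 0$ (packet $1$ on top, empty packets allowed), $A_1+\cdots+A_a=n$, with probability $a^{-n}\binom{n}{A_1,\dots,A_a}$; the packets are then riffled together by dropping cards one at a time from the bottoms of the packets, the next card coming from a given packet with probability proportional to its current size (equivalently, all interleavings preserving the order within each packet are equally likely). *)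

theory Defs
  imports "HOL-Probability.Probability" "HOL-Computational_Algebra.Computational_Algebra"
begin

text \<open>A deck is a list whose head is the top card.\<close>

subsection \<open>Cutting the deck\<close>

text \<open>The law of the packet sizes \<open>[A\<^sub>1, \<dots>, A\<^sub>a]\<close>. It is a probability distribution only when
  \<open>a \<ge> 1\<close> or \<open>n = 0\<close>, and \<^term>\<open>embed_pmf\<close> is unspecified otherwise.\<close>

definition cut_sizes :: "nat \<Rightarrow> nat \<Rightarrow> nat list pmf" where
  "cut_sizes a n = embed_pmf (\<lambda>A.
     if length A = a \<and> sum_list A = n
     then fact n / (\<Prod>m\<leftarrow>A. fact m) / real a ^ n else 0)"

lemma pmf_cut_sizes:
  assumes "a \<ge> 1"
  shows "pmf (cut_sizes a n) A =
    (if length A = a \<and> sum_list A = n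
     then fact n / (\<Prod>m\<leftarrow>A. fact m) / real a ^ n else 0)"
proof -
  let ?f = "\<lambda>A. if length A = a \<and> sum_list A = n
     then fact n / (\<Prod>m\<leftarrow>A. fact m) / real a ^ n else (0::real)"
  have fin: "finite (natpermute n a)"
    by (rule natpermute_finite)
  have nonneg: "?f A \<ge> 0" for A
  proof -
    have "(\<Prod>m\<leftarrow>A. fact m :: real) \<ge> 0"
      by (induction A) auto
    then show ?thesis
      by simp
  qed
  obtain k where k: "a = Suc k"
    using assms by (cases a) auto
  have "(\<Sum>v\<in>natpermute n a. \<Prod>j\<in>{0..k}. fps_nth (fps_exp (1::real)) (v ! j)) =
      fps_nth (fps_exp (1::real) ^ a) n"
    unfolding k by (simp only: fps_power_nth_Suc Suc_eq_plus1 [symmetric])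
  also have "\<dots> = real a ^ n / fact n"
    by (simp add: fps_exp_power_mult)
  finally have *: "(\<Sum>v\<in>natpermute n a. \<Prod>j\<in>{0..k}. 1 / fact (v ! j)) = real a ^ n / fact n"
    by simp
  have "(\<Sum>A\<in>natpermute n a. ?f A) =
      (\<Sum>v\<in>natpermute n a. (\<Prod>j\<in>{0..k}. 1 / fact (v ! j)) * (fact n / real a ^ n))"
  proof (rule sum.cong [OF refl])
    fix v assume "v \<in> natpermute n a"
    then have v: "length v = a" "sum_list v = n"
      by (auto simp: natpermute_def)
    have "(\<Prod>m\<leftarrow>v. fact m :: real) = (\<Prod>j\<in>{0..k}. fact (v ! j))"
      using v k by (simp add: prod.list_conv_set_nth atLeastLessThanSuc_atLeastAtMost)
    then show "?f v = (\<Prod>j\<in>{0..k}. 1 / fact (v ! j)) * (fact n / real a ^ n)"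
      using v by (simp add: prod_dividef)
  qed
  also have "\<dots> = 1"
    unfolding sum_distrib_right [symmetric] * using assms by simp
  finally have sum1: "(\<Sum>A\<in>natpermute n a. ?f A) = 1" .
  have "(\<integral>\<^sup>+A. ennreal (?f A) \<partial>count_space UNIV) = (\<Sum>A\<in>natpermute n a. ennreal (?f A))"
    by (rule nn_integral_count_space'[OF fin]) (auto simp: natpermute_def)
  also have "\<dots> = 1"
    by (simp only: sum_ennreal nonneg sum1 ennreal_1)
  finally show ?thesis
    unfolding cut_sizes_def by (rule pmf_embed_pmf [OF nonneg])
qed

primrec cut_deck :: "nat list \<Rightarrow> 'c list \<Rightarrow> 'c list list" where
  "cut_deck [] xs = []"
| "cut_deck (m # ms) xs = take m xs # cut_deck ms (drop m xs)"

subsection \<open>Riffling the packets together\<close>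

text \<open>The index of the packet that drops the next card; this is a probability distribution as
  long as some packet is nonempty.\<close>

definition next_packet :: "'c list list \<Rightarrow> nat pmf" where
  "next_packet ps = embed_pmf (\<lambda>i.
     if i < length ps then real (length (ps ! i)) / (\<Sum>p\<leftarrow>ps. real (length p)) else 0)"

lemma pmf_next_packet:
  assumes "concat ps \<noteq> []"
  shows "pmf (next_packet ps) i =
    (if i < length ps then real (length (ps ! i)) / (\<Sum>p\<leftarrow>ps. real (length p)) else 0)"
proof -
  let ?s = "\<Sum>p\<leftarrow>ps. real (length p)"
  let ?f = "\<lambda>i. if i < length ps then real (length (ps ! i)) / ?s else 0"
  have s: "?s = real (length (concat ps))"
    by (induction ps) auto
  have s_pos: "?s > 0"
    using assms unfolding s of_nat_0_less_iff length_greater_0_conv by simp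
  have nonneg: "?f i \<ge> 0" for i
    using s_pos by simp
  have "?s = (\<Sum>i<length ps. real (length (ps ! i)))"
    by (simp add: sum_list_sum_nth atLeast0LessThan)
  then have sum1: "(\<Sum>i<length ps. ?f i) = 1"
    using s_pos by (simp add: sum_divide_distrib [symmetric])
  have "(\<integral>\<^sup>+i. ennreal (?f i) \<partial>count_space UNIV) = (\<Sum>i<length ps. ennreal (?f i))"
    by (rule nn_integral_count_space') auto
  also have "\<dots> = 1"
    by (simp only: sum_ennreal nonneg sum1 ennreal_1)
  finally show ?thesis
    unfolding next_packet_def by (rule pmf_embed_pmf [OF nonneg])
qed

text \<open>\<open>riffle n ps pile\<close> drops \<open>n\<close> cards, one at a time, from the bottoms of the packets \<open>ps\<close>
  onto the top of \<open>pile\<close>.\<close>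

primrec riffle :: "nat \<Rightarrow> 'c list list \<Rightarrow> 'c list \<Rightarrow> 'c list pmf" where
  "riffle 0 ps pile = return_pmf pile"
| "riffle (Suc n) ps pile =
     bind_pmf (next_packet ps) (\<lambda>i. riffle n (ps[i := butlast (ps ! i)]) (last (ps ! i) # pile))"

definition shuffle :: "nat \<Rightarrow> 'c list \<Rightarrow> 'c list pmf" where
  "shuffle a deck =
     bind_pmf (cut_sizes a (length deck)) (\<lambda>A. riffle (length deck) (cut_deck A deck) [])"

subsection \<open>Two-coloured decks\<close>

datatype colour = Red | Black

definition red_black_deck :: "nat \<Rightarrow> nat \<Rightarrow> colour list" where
  "red_black_deck R B = replicate R Red @ replicate B Black"

text \<open>The red cards are counted from the top starting with \<open>j = 1\<close>, whereas positions in the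
  list start with \<open>0\<close>.\<close>

definition red_position :: "colour list \<Rightarrow> nat \<Rightarrow> nat" where
  "red_position w j = filter (\<lambda>i. w ! i = Red) [0..<length w] ! (j - 1)"

definition blacks_above :: "colour list \<Rightarrow> nat \<Rightarrow> nat" where
  "blacks_above w j = count_list (take (red_position w j) w) Black"

end

theory Submission
  imports Defs
begin

text \<open>
  Label every position of the shuffled deck by the packet its card came from. The resulting word
  over \<open>a\<close> letters is uniformly distributed: the multinomial weight of the cut cancels against the
  number of equally likely interleavings (\<open>pmf_riffle\<close>, \<open>pmf_shuffle\<close>). Conversely the word
  determines the shuffled deck, because the card at position \<open>p\<close> was, before the shuffle, at the
  position that \<open>p\<close> takes when the positions are stably sorted by their labels. So the probability
  of a configuration \<open>w\<close> is the number of words that send exactly the red positions of \<open>w\<close> to the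
  first \<open>R\<close> ranks, divided by the number of all words.

  Such words are classified by the position of the red card that was lowest in the original deck:
  say it is the \<open>j\<close>-th red card of \<open>w\<close>, and that it has label \<open>k\<close> in \<open>{1..a}\<close>. The red positions
  form an initial segment of the stable sort iff every other red position precedes this one and
  every black position follows it (\<open>initial_segment_iff_greatest\<close>). Comparing with a fixed
  position constrains each remaining label on its own: a red card has a label \<open>\<le> k\<close> when it is above
  the \<open>j\<close>-th red card and \<open>< k\<close> when below, a black card has a label \<open>> k\<close> when above and \<open>\<ge> k\<close>
  when below. The number of words is then a product, which is the \<open>(k, j)\<close> summand of the formula
  (\<open>card_last_red_at\<close>). The labels of the formal words start at \<open>0\<close>, so that \<open>k\<close> is shifted by
  one until the last step.
\<close>

section \<open>Riffling as a uniformly random word of packet labels\<close>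

text \<open>The word \<open>L\<close> names, from the top of the shuffled deck to its bottom, the packet each card comes
  from. As every packet keeps its order, the card at position \<open>p\<close> sits in its packet below exactly
  the cards that an earlier occurrence of the same label stands for.\<close>

definition deal :: "'c list list \<Rightarrow> nat list \<Rightarrow> 'c list" where
  "deal ps L = map (\<lambda>p. ps ! (L ! p) ! count_list (take p L) (L ! p)) [0..<length L]"

definition interleavings :: "'c list list \<Rightarrow> nat list set" where
  "interleavings ps = {L. set L \<subseteq> {..<length ps} \<and>
     (\<forall>i<length ps. count_list L i = length (ps ! i))}"

lemma length_concat_nth: "length (concat ps) = (\<Sum>i<length ps. length (ps ! i))"
  by (simp add: length_concat sum_list_sum_nth atLeast0LessThan)

lemma length_interleavings:
  assumes "L \<in> interleavings ps"
  shows "length L = length (concat ps)"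
proof -
  have "length L = (\<Sum>i<length ps. count_list L i)"
    using assms by (subst sum_count_set) (auto simp: interleavings_def)
  also have "\<dots> = (\<Sum>i<length ps. length (ps ! i))"
    using assms by (intro sum.cong) (auto simp: interleavings_def)
  finally show ?thesis by (simp add: length_concat_nth)
qed

lemma finite_interleavings: "finite (interleavings ps)"
proof (rule finite_subset)
  show "interleavings ps \<subseteq> {L. set L \<subseteq> {..<length ps} \<and> length L = length (concat ps)}"
    using length_interleavings by (auto simp: interleavings_def)
  show "finite {L. set L \<subseteq> {..<length ps} \<and> length L = length (concat ps)}"
    by (rule finite_lists_length_eq) simp
qed

text \<open>The last letter of a word describes the bottom card of the shuffled deck, which is the first card
  to be dropped. This lemma and \<open>deal_snoc\<close> follow the recursion of \<open>riffle\<close>.\<close>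

lemma interleavings_snoc:
  assumes "i < length ps" "ps ! i \<noteq> []"
  shows "L @ [i] \<in> interleavings ps \<longleftrightarrow> L \<in> interleavings (ps[i := butlast (ps ! i)])"
proof -
  have "count_list (L @ [i]) m = length (ps ! m) \<longleftrightarrow>
      count_list L m = length (ps[i := butlast (ps ! i)] ! m)" if "m < length ps" for m
    using that assms by (cases "ps ! i" rule: rev_cases) (auto simp: nth_list_update)
  then show ?thesis
    using assms by (auto simp: interleavings_def)
qed

lemma count_list_take_less:
  assumes "p < length L"
  shows "count_list (take p L) (L ! p) < count_list L (L ! p)"
proof -
  have "count_list L (L ! p) = count_list (take p L @ L ! p # drop (Suc p) L) (L ! p)"
    using assms by (simp add: id_take_nth_drop [symmetric])
  then show ?thesis by simp
qed

lemma deal_snoc: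
  assumes i: "i < length ps" "ps ! i \<noteq> []"
    and L: "L \<in> interleavings (ps[i := butlast (ps ! i)])"
  shows "deal ps (L @ [i]) = deal (ps[i := butlast (ps ! i)]) L @ [last (ps ! i)]"
proof -
  let ?ps = "ps[i := butlast (ps ! i)]"
  have cnt: "count_list L m = length (?ps ! m)" if "m < length ps" for m
    using L that by (auto simp: interleavings_def)
  have "ps ! (L ! p) ! count_list (take p L) (L ! p) = ?ps ! (L ! p) ! count_list (take p L) (L ! p)"
    if "p < length L" for p
  proof -
    have "L ! p < length ps"
      using L nth_mem[OF that] unfolding interleavings_def
      by (metis (no_types, lifting) length_list_update lessThan_iff mem_Collect_eq subsetD)
    then have "count_list (take p L) (L ! p) < length (?ps ! (L ! p))"
      using count_list_take_less[OF that] cnt by simp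
    then show ?thesis
      using i by (auto simp: nth_list_update nth_butlast)
  qed
  moreover have "ps ! i ! count_list L i = last (ps ! i)"
    using cnt[OF i(1)] i by (simp add: last_conv_nth)
  ultimately show ?thesis
    by (simp add: deal_def nth_append)
qed

text \<open>Dropping from packet \<open>i\<close> has probability proportional to its size, and this factor turns the
  factorial of the reduced size back into that of the full one. Hence all interleavings carry the
  same weight, the inverse of a multinomial coefficient. They are counted as words and not as decks,
  since different words may yield the same deck when cards are indistinguishable.\<close>

lemma pmf_riffle:
  assumes "length (concat ps) = n"
  shows "pmf (riffle n ps pile) w =
    (\<Prod>i<length ps. fact (length (ps ! i))) / fact n *
      real (card {L \<in> interleavings ps. deal ps L @ pile = w})"
  using assms
proof (induction n arbitrary: ps pile)
  case 0
  then have empty: "ps ! i = []" if "i < length ps" for i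
    using that by simp
  have "interleavings ps = {[]}"
    using length_interleavings[of _ ps] 0 empty by (auto simp: interleavings_def)
  then have "{L \<in> interleavings ps. deal ps L @ pile = w} = (if pile = w then {[]} else {})"
    by (auto simp: deal_def)
  then show ?case
    using empty by simp
next
  case (Suc n)
  let ?upd = "\<lambda>i. ps[i := butlast (ps ! i)]"
  let ?W = "\<lambda>ps. \<Prod>i<length ps. fact (length (ps ! i)) :: real"
  let ?D = "\<lambda>ps pile. {L \<in> interleavings ps. deal ps L @ pile = w}"
  let ?I = "{i. i < length ps \<and> ps ! i \<noteq> []}"
  have ne: "concat ps \<noteq> []"
    using Suc.prems by (metis length_0_conv nat.distinct(1))
  have total: "(\<Sum>p\<leftarrow>ps. real (length p)) = real (Suc n)"
    unfolding Suc.prems [symmetric] by (induction ps) auto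
  have step: "pmf (riffle n (?upd i) (last (ps ! i) # pile)) w * real (length (ps ! i)) =
      ?W ps / fact n * real (card (?D (?upd i) (last (ps ! i) # pile)))" if "i \<in> ?I" for i
  proof -
    have i: "i < length ps" "ps ! i \<noteq> []"
      using that by auto
    have "length (concat ps) = length (ps ! i) + (\<Sum>m\<in>{..<length ps} - {i}. length (ps ! m))"
      unfolding length_concat_nth using i by (intro sum.remove) auto
    moreover have "length (concat (?upd i)) =
        length (butlast (ps ! i)) + (\<Sum>m\<in>{..<length ps} - {i}. length (?upd i ! m))"
      unfolding length_concat_nth using i by (subst sum.remove[of _ i]) auto
    moreover have "(\<Sum>m\<in>{..<length ps} - {i}. length (?upd i ! m)) =
        (\<Sum>m\<in>{..<length ps} - {i}. length (ps ! m))"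
      by (intro sum.cong) auto
    ultimately have "length (concat (?upd i)) = n"
      using Suc.prems i by (cases "ps ! i") auto
    note IH = Suc.IH[OF this, of "last (ps ! i) # pile"]
    have W: "?W (?upd i) * real (length (ps ! i)) = ?W ps"
    proof -
      have "?W (?upd i) = fact (length (butlast (ps ! i))) *
          (\<Prod>m\<in>{..<length ps} - {i}. fact (length (?upd i ! m)))"
        using i by (subst prod.remove[of _ i]) auto
      also have "(\<Prod>m\<in>{..<length ps} - {i}. fact (length (?upd i ! m))) =
          (\<Prod>m\<in>{..<length ps} - {i}. fact (length (ps ! m)) :: real)"
        by (intro prod.cong) auto
      finally have "?W (?upd i) = fact (length (ps ! i) - 1) *
          (\<Prod>m\<in>{..<length ps} - {i}. fact (length (ps ! m)))" by simp
      moreover have "?W ps = fact (length (ps ! i)) *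
          (\<Prod>m\<in>{..<length ps} - {i}. fact (length (ps ! m)))"
        using i by (intro prod.remove) auto
      moreover have "(fact (length (ps ! i)) :: real) =
          real (length (ps ! i)) * fact (length (ps ! i) - 1)"
        using i by (intro fact_reduce) simp
      ultimately show ?thesis by simp
    qed
    show ?thesis
      unfolding IH W [symmetric] by (simp only: times_divide_eq_left times_divide_eq_right mult_ac)
  qed
  \<comment> \<open>Words are sorted by their last letter; an empty packet cannot be the source of a card.\<close>
  have split: "?D ps pile =
      (\<Union>i\<in>?I. (\<lambda>L. L @ [i]) ` ?D (?upd i) (last (ps ! i) # pile))" (is "_ = ?U")
  proof (intro equalityI subsetI)
    fix L assume L: "L \<in> ?D ps pile"
    then have "length L = Suc n"
      using length_interleavings[of L ps] Suc.prems by simp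
    then obtain L' i where L': "L = L' @ [i]"
      by (cases L rule: rev_cases) auto
    have i: "i < length ps"
      using L L' by (auto simp: interleavings_def)
    have "count_list L i = length (ps ! i)"
      using L i by (auto simp: interleavings_def)
    with i L' have "i \<in> ?I"
      by auto
    moreover have "L' \<in> ?D (?upd i) (last (ps ! i) # pile)"
      using L L' \<open>i \<in> ?I\<close> interleavings_snoc[of i ps L'] deal_snoc[of i ps L'] by auto
    ultimately show "L \<in> ?U"
      using L' by blast
  next
    fix L assume "L \<in> ?U"
    then obtain i L' where *: "i \<in> ?I" "L = L' @ [i]" "L' \<in> ?D (?upd i) (last (ps ! i) # pile)"
      by blast
    then show "L \<in> ?D ps pile"
      using interleavings_snoc[of i ps L'] deal_snoc[of i ps L'] by auto
  qed
  have card: "card (?D ps pile) = (\<Sum>i\<in>?I. card (?D (?upd i) (last (ps ! i) # pile)))"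
    unfolding split
    by (subst card_UN_disjoint) (auto simp: finite_interleavings card_image inj_on_def)
  have "pmf (riffle (Suc n) ps pile) w =
      (\<Sum>i<length ps. pmf (riffle n (?upd i) (last (ps ! i) # pile)) w * pmf (next_packet ps) i)"
    unfolding riffle.simps pmf_bind
    by (rule integral_measure_pmf_real) (auto simp: set_pmf_iff pmf_next_packet[OF ne] split: if_splits)
  also have "\<dots> = (\<Sum>i\<in>?I. pmf (riffle n (?upd i) (last (ps ! i) # pile)) w * pmf (next_packet ps) i)"
    by (rule sum.mono_neutral_right) (auto simp: pmf_next_packet[OF ne])
  also have "\<dots> = (\<Sum>i\<in>?I. pmf (riffle n (?upd i) (last (ps ! i) # pile)) w *
      real (length (ps ! i)) / real (Suc n))"
    by (intro sum.cong) (auto simp: pmf_next_packet[OF ne] total)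
  also have "\<dots> = (\<Sum>i\<in>?I. ?W ps / fact (Suc n) *
      real (card (?D (?upd i) (last (ps ! i) # pile))))"
    by (intro sum.cong refl) (simp only: step, simp)
  also have "\<dots> = ?W ps / fact (Suc n) * real (card (?D ps pile))"
    by (simp only: sum_distrib_left [symmetric] card of_nat_sum)
  finally show ?case .
qed

section \<open>The shuffled deck as a stable sort of a random word\<close>

lemma length_cut_deck: "length (cut_deck A xs) = length A"
  by (induction A arbitrary: xs) auto

lemma concat_cut_deck:
  "length xs \<le> sum_list A \<Longrightarrow> concat (cut_deck A xs) = xs"
  by (induction A arbitrary: xs) auto

lemma length_cut_deck_nth:
  assumes "sum_list A \<le> length xs" "i < length A"
  shows "length (cut_deck A xs ! i) = A ! i"
  using assms by (induction A arbitrary: xs i) (auto simp: nth_Cons split: nat.splits)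

lemma cut_deck_nth_nth:
  assumes "sum_list A \<le> length xs" "i < length A" "j < A ! i"
  shows "cut_deck A xs ! i ! j = xs ! (sum_list (take i A) + j)"
  using assms
proof (induction A arbitrary: xs i)
  case (Cons m A)
  show ?case
  proof (cases i)
    case (Suc i')
    then show ?thesis
      using Cons by (simp add: add.assoc)
  qed (use Cons in auto)
qed simp

text \<open>The position of \<open>p\<close> after a stable sort of the positions by their labels.\<close>

definition sort_rank :: "nat list \<Rightarrow> nat \<Rightarrow> nat" where
  "sort_rank L p = card {q. q < length L \<and> (L ! q < L ! p \<or> L ! q = L ! p \<and> q < p)}"

lemma count_list_conv_card: "count_list xs x = card {i. i < length xs \<and> xs ! i = x}"
  unfolding count_list_eq_length_filter length_filter_conv_card
  by (rule arg_cong[where f = card]) auto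

text \<open>The two summands are the offset of the packet of \<open>p\<close> in the original deck and the place of the
  card within that packet.\<close>

lemma sort_rank_conv_sum:
  assumes "p < length L"
  shows "sort_rank L p = (\<Sum>i<L ! p. count_list L i) + count_list (take p L) (L ! p)"
proof -
  have split: "{q. q < length L \<and> (L ! q < L ! p \<or> L ! q = L ! p \<and> q < p)} =
      (\<Union>i\<in>{..<L ! p}. {q. q < length L \<and> L ! q = i}) \<union> {q. q < p \<and> L ! q = L ! p}"
    using assms by auto
  have "sort_rank L p = card (\<Union>i\<in>{..<L ! p}. {q. q < length L \<and> L ! q = i}) +
      card {q. q < p \<and> L ! q = L ! p}"
    unfolding sort_rank_def split by (rule card_Un_disjoint) auto
  also have "card (\<Union>i\<in>{..<L ! p}. {q. q < length L \<and> L ! q = i}) =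
      (\<Sum>i<L ! p. card {q. q < length L \<and> L ! q = i})"
    by (rule card_UN_disjoint) auto
  also have "\<dots> = (\<Sum>i<L ! p. count_list L i)"
    by (simp add: count_list_conv_card)
  also have "{q. q < p \<and> L ! q = L ! p} = {q. q < length (take p L) \<and> take p L ! q = L ! p}"
    using assms by auto
  finally show ?thesis
    by (simp only: count_list_conv_card)
qed

lemma deal_cut_deck:
  assumes L: "L \<in> interleavings (cut_deck A deck)" and A: "sum_list A = length deck"
  shows "deal (cut_deck A deck) L = map (\<lambda>p. deck ! sort_rank L p) [0..<length deck]"
proof -
  have len: "length L = length deck"
    using length_interleavings[OF L] A by (simp add: concat_cut_deck)
  have labels: "set L \<subseteq> {..<length A}" and cnt: "\<And>i. i < length A \<Longrightarrow> count_list L i = A ! i"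
    using L A by (auto simp: interleavings_def length_cut_deck length_cut_deck_nth)
  have "cut_deck A deck ! (L ! p) ! count_list (take p L) (L ! p) = deck ! sort_rank L p"
    if p: "p < length L" for p
  proof -
    have lt: "L ! p < length A"
      using labels nth_mem[OF p] by blast
    have "sum_list (take (L ! p) A) = (\<Sum>i<L ! p. count_list L i)"
      using lt cnt by (simp add: sum_list_sum_nth atLeast0LessThan)
    then show ?thesis
      using lt A cnt[OF lt] count_list_take_less[OF p]
      by (simp add: cut_deck_nth_nth sort_rank_conv_sum[OF p])
  qed
  then show ?thesis
    by (simp add: deal_def len)
qed

text \<open>A word determines the packet sizes as its letter counts, so the interleavings of all possible cuts
  partition the set of all words; and the multinomial probability of a cut cancels the weight that
  \<open>pmf_riffle\<close> gives to each of its interleavings.\<close>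

lemma pmf_shuffle:
  assumes "a \<ge> 1"
  shows "pmf (shuffle a deck) w =
    real (card {L. length L = length deck \<and> set L \<subseteq> {..<a} \<and>
      map (\<lambda>p. deck ! sort_rank L p) [0..<length deck] = w}) / real a ^ length deck"
proof -
  let ?n = "length deck"
  let ?As = "natpermute ?n a"
  let ?D = "\<lambda>A. {L \<in> interleavings (cut_deck A deck). deal (cut_deck A deck) L = w}"
  let ?E = "{L. length L = ?n \<and> set L \<subseteq> {..<a} \<and> map (\<lambda>p. deck ! sort_rank L p) [0..<?n] = w}"
  have A: "length A = a" "sum_list A = ?n" if "A \<in> ?As" for A
    using that by (auto simp: natpermute_def)
  have "pmf (shuffle a deck) w =
      (\<Sum>A\<in>?As. pmf (riffle ?n (cut_deck A deck) []) w * pmf (cut_sizes a ?n) A)"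
    unfolding shuffle_def pmf_bind using natpermute_finite
    by (rule integral_measure_pmf_real)
      (auto simp: set_pmf_iff pmf_cut_sizes[OF assms] natpermute_def split: if_splits)
  also have "\<dots> = (\<Sum>A\<in>?As. real (card (?D A)) / real a ^ ?n)"
  proof (rule sum.cong [OF refl])
    fix A assume "A \<in> ?As"
    note A = A[OF this]
    have pos: "(\<Prod>i<a. fact (A ! i) :: real) \<noteq> 0"
      by simp
    have r: "pmf (riffle ?n (cut_deck A deck) []) w =
        (\<Prod>i<a. fact (A ! i)) / fact ?n * real (card (?D A))"
      using A by (subst pmf_riffle) (auto simp: concat_cut_deck length_cut_deck length_cut_deck_nth)
    have c: "pmf (cut_sizes a ?n) A = fact ?n / (\<Prod>i<a. fact (A ! i)) / real a ^ ?n"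
      using A by (simp add: pmf_cut_sizes[OF assms] prod.list_conv_set_nth atLeast0LessThan)
    show "pmf (riffle ?n (cut_deck A deck) []) w * pmf (cut_sizes a ?n) A =
        real (card (?D A)) / real a ^ ?n"
      unfolding r c using pos by (simp add: field_simps)
  qed
  also have "\<dots> = real (\<Sum>A\<in>?As. card (?D A)) / real a ^ ?n"
    by (simp add: sum_divide_distrib)
  also have "(\<Sum>A\<in>?As. card (?D A)) = card (\<Union>A\<in>?As. ?D A)"
  proof (rule card_UN_disjoint [symmetric])
    show "\<forall>A\<in>?As. \<forall>A'\<in>?As. A \<noteq> A' \<longrightarrow> ?D A \<inter> ?D A' = {}"
    proof (intro ballI impI equals0I)
      fix A A' L assume AA: "A \<in> ?As" "A' \<in> ?As" "A \<noteq> A'" and L: "L \<in> ?D A \<inter> ?D A'"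
      have "A ! i = A' ! i" if "i < a" for i
        using L that A[OF AA(1)] A[OF AA(2)]
        by (auto simp: interleavings_def length_cut_deck length_cut_deck_nth)
      then have "A = A'"
        using A[OF AA(1)] A[OF AA(2)] by (intro nth_equalityI) auto
      with AA show False by simp
    qed
  qed (auto simp: finite_interleavings natpermute_finite)
  also have "(\<Union>A\<in>?As. ?D A) = ?E"
  proof (intro equalityI subsetI)
    fix L assume "L \<in> (\<Union>A\<in>?As. ?D A)"
    then obtain A where *: "A \<in> ?As" "L \<in> ?D A"
      by blast
    then have "length L = ?n"
      using length_interleavings[of L "cut_deck A deck"] A[OF *(1)] by (simp add: concat_cut_deck)
    then show "L \<in> ?E"
      using * A[OF *(1)] deal_cut_deck[of L A deck]
      by (auto simp: interleavings_def length_cut_deck)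
  next
    fix L assume L: "L \<in> ?E"
    let ?A = "map (count_list L) [0..<a]"
    have sum: "sum_list ?A = ?n"
      using L sum_count_set[of L "{..<a}"]
      by (simp add: interv_sum_list_conv_sum_set_nat atLeast0LessThan)
    then have "?A \<in> ?As"
      by (simp add: natpermute_def)
    moreover have "L \<in> interleavings (cut_deck ?A deck)"
      using L sum by (auto simp: interleavings_def length_cut_deck length_cut_deck_nth)
    ultimately show "L \<in> (\<Union>A\<in>?As. ?D A)"
      using L sum deal_cut_deck[of L ?A deck] by auto
  qed
  finally show ?thesis .
qed

section \<open>Red cards as an initial segment of the sorted word\<close>

text \<open>A set whose elements have the smallest ranks is a down-set, and a nonempty finite down-set of a
  linear order is described by its greatest element. The right-hand side replaces ranks, which
  depend on all keys at once, by comparisons with a single key.\<close>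

lemma initial_segment_iff_greatest:
  fixes key :: "'a \<Rightarrow> 'b :: linorder"
  assumes P: "finite P" and inj: "inj_on key P" and S: "S \<subseteq> P" "S \<noteq> {}"
  shows "(\<forall>p\<in>P. p \<in> S \<longleftrightarrow> card {q \<in> P. key q < key p} < card S) \<longleftrightarrow>
    (\<exists>p\<in>S. \<forall>q\<in>P - {p}. q \<in> S \<longleftrightarrow> key q < key p)" (is "?L \<longleftrightarrow> ?R")
proof
  let ?rank = "\<lambda>p. card {q \<in> P. key q < key p}"
  have finS: "finite S"
    using P S finite_subset by blast
  {
    assume ?L
    have "Max (key ` S) \<in> key ` S"
      using finS S(2) by (intro Max_in) auto
    then obtain p where p: "p \<in> S" "key p = Max (key ` S)"
      by (metis imageE)
    have "q \<in> S \<longleftrightarrow> key q < key p" if q: "q \<in> P - {p}" for q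
    proof
      assume "q \<in> S"
      then have "key q \<le> key p"
        using finS p by simp
      moreover have "key q \<noteq> key p"
        using inj_onD[OF inj, of q p] q p(1) S(1) by blast
      ultimately show "key q < key p"
        by simp
    next
      assume "key q < key p"
      then have "?rank q \<le> ?rank p"
        using P by (intro card_mono) auto
      also have "\<dots> < card S"
        using \<open>?L\<close> p S by blast
      finally show "q \<in> S"
        using \<open>?L\<close> q by blast
    qed
    then show ?R
      using p by blast
  }
  assume ?R
  then obtain p where p: "p \<in> S" and iff: "\<And>q. q \<in> P \<Longrightarrow> q \<noteq> p \<Longrightarrow> q \<in> S \<longleftrightarrow> key q < key p"
    by blast
  have rank_p: "{q \<in> P. key q < key p} = S - {p}"
    using iff S by auto
  then have rank_p': "?rank p < card S"
    using card_Diff1_less[OF finS p] by (simp only: rank_p)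
  show ?L
  proof
    fix q assume q: "q \<in> P"
    show "q \<in> S \<longleftrightarrow> ?rank q < card S"
    proof (cases "q \<in> S")
      case True
      then have "key q \<le> key p"
        using iff[OF q] by (cases "q = p") auto
      then have "?rank q \<le> ?rank p"
        using P by (intro card_mono) auto
      with True rank_p' show ?thesis
        by simp
    next
      case False
      then have "key p < key q"
        using iff[OF q] inj_onD[OF inj, of p q] p q S(1) by (metis linorder_neqE subsetD)
      have "S \<subseteq> {r \<in> P. key r < key q}"
      proof
        fix r assume "r \<in> S"
        then have "r = p \<or> key r < key p"
          using rank_p by blast
        then have "key r \<le> key p"
          by auto
        with \<open>r \<in> S\<close> show "r \<in> {r \<in> P. key r < key q}"
          using \<open>key p < key q\<close> S(1) by auto
      qed
      then have "card S \<le> ?rank q"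
        using P by (intro card_mono) auto
      with False show ?thesis
        by simp
    qed
  qed
qed

lemma card_lists_nth_in:
  "card {L. length L = n \<and> (\<forall>q<n. L ! q \<in> A q)} = (\<Prod>q<n. card (A q))"
proof (induction n)
  case 0
  have "{L :: 'a list. length L = 0 \<and> (\<forall>q<0. L ! q \<in> A q)} = {[]}"
    by auto
  then show ?case by simp
next
  case (Suc n)
  let ?S = "\<lambda>n. {L. length L = n \<and> (\<forall>q<n. L ! q \<in> A q)}"
  have eq: "?S (Suc n) = (\<lambda>(L, x). L @ [x]) ` (?S n \<times> A n)"
  proof (intro equalityI subsetI)
    fix L assume L: "L \<in> ?S (Suc n)"
    then have "L = butlast L @ [last L]"
      by (metis (mono_tags, lifting) append_butlast_last_id length_0_conv mem_Collect_eq nat.distinct(1))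
    moreover have "butlast L \<in> ?S n"
      using L by (auto simp: nth_butlast)
    moreover have "last L \<in> A n"
      using L by (cases "L = []") (auto simp: last_conv_nth)
    ultimately show "L \<in> (\<lambda>(L, x). L @ [x]) ` (?S n \<times> A n)"
      by force
  next
    fix L assume "L \<in> (\<lambda>(L, x). L @ [x]) ` (?S n \<times> A n)"
    then show "L \<in> ?S (Suc n)"
      by (auto simp: nth_append less_Suc_eq)
  qed
  have "inj_on (\<lambda>(L, x). L @ [x]) (?S n \<times> A n)"
    by (auto simp: inj_on_def)
  then show ?case
    unfolding eq using Suc by (simp add: card_image card_cartesian_product)
qed

lemma red_black_deck_nth:
  "r < R + B \<Longrightarrow> red_black_deck R B ! r = Red \<longleftrightarrow> r < R"
  by (auto simp: red_black_deck_def nth_append)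

definition red_positions :: "colour list \<Rightarrow> nat set" where
  "red_positions w = {p. p < length w \<and> w ! p = Red}"

lemma colour_list_eq_iff:
  assumes "length v = length w"
  shows "v = w \<longleftrightarrow> (\<forall>p<length w. v ! p = Red \<longleftrightarrow> w ! p = Red)"
proof -
  have "v ! p = w ! p \<longleftrightarrow> (v ! p = Red \<longleftrightarrow> w ! p = Red)" for p
    by (cases "v ! p"; cases "w ! p") auto
  then show ?thesis
    using assms by (simp add: list_eq_iff_nth_eq)
qed

lemma length_eq_count_colours: "length w = count_list w Red + count_list w Black"
proof (induction w)
  case (Cons c w)
  then show ?case by (cases c) auto
qed simp

text \<open>An encoding of the lexicographic order on (label, position) into the natural numbers: positions
  are smaller than \<open>length L\<close>, so they act as a lower digit.\<close>

definition sort_key :: "nat list \<Rightarrow> nat \<Rightarrow> nat" where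
  "sort_key L p = L ! p * length L + p"

lemma sort_key_less_iff:
  assumes "p < length L" "q < length L"
  shows "sort_key L q < sort_key L p \<longleftrightarrow> L ! q < L ! p \<or> L ! q = L ! p \<and> q < p"
proof -
  have less: "L ! s * length L + s < L ! t * length L + t"
    if "L ! s < L ! t" "s < length L" for s t
  proof -
    have "L ! s * length L + s < Suc (L ! s) * length L"
      using that by simp
    also have "\<dots> \<le> L ! t * length L"
      using that by (intro mult_le_mono1) simp
    finally show ?thesis by simp
  qed
  show ?thesis
    using less[of p q] less[of q p] assms
    by (cases "L ! q" "L ! p" rule: linorder_cases) (auto simp: sort_key_def)
qed

lemma inj_on_sort_key: "inj_on (sort_key L) {..<length L}"
proof (rule inj_onI)
  fix p q assume "p \<in> {..<length L}" "q \<in> {..<length L}" "sort_key L p = sort_key L q"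
  then show "p = q"
    using sort_key_less_iff[of p L q] sort_key_less_iff[of q L p] by auto
qed

lemma sort_rank_conv_sort_key:
  assumes "p < length L"
  shows "sort_rank L p = card {q \<in> {..<length L}. sort_key L q < sort_key L p}"
  unfolding sort_rank_def
  by (rule arg_cong[where f = card]) (use sort_key_less_iff[OF assms] in auto)

text \<open>Meant for a red position \<open>p\<close> of \<open>w\<close>: the card there was the lowest red card of the original deck,
  with all other red cards above it and all black cards below it.\<close>

definition last_red_at :: "colour list \<Rightarrow> nat list \<Rightarrow> nat \<Rightarrow> bool" where
  "last_red_at w L p \<longleftrightarrow> (\<forall>q<length w. q \<noteq> p \<longrightarrow>
     (w ! q = Red \<longleftrightarrow> L ! q < L ! p \<or> L ! q = L ! p \<and> q < p))"

lemma sorts_to_red_black_iff: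
  assumes R: "count_list w Red = R" "R \<ge> 1" and B: "count_list w Black = B"
    and L: "length L = length w"
  shows "map (\<lambda>p. red_black_deck R B ! sort_rank L p) [0..<length w] = w \<longleftrightarrow>
    (\<exists>p\<in>red_positions w. last_red_at w L p)"
proof -
  have cardS: "card (red_positions w) = R"
    using R by (simp add: red_positions_def count_list_conv_card)
  have "sort_rank L p < R + B" if "p < length w" for p
  proof -
    have "sort_rank L p < card {..<length L}"
      unfolding sort_rank_def using that L by (intro psubset_card_mono) auto
    then show ?thesis
      using length_eq_count_colours[of w] L R B by simp
  qed
  then have "map (\<lambda>p. red_black_deck R B ! sort_rank L p) [0..<length w] = w \<longleftrightarrow>
      (\<forall>p<length w. sort_rank L p < R \<longleftrightarrow> w ! p = Red)"
    by (subst colour_list_eq_iff) (auto simp: red_black_deck_nth)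
  also have "\<dots> \<longleftrightarrow> (\<forall>p\<in>{..<length L}. p \<in> red_positions w \<longleftrightarrow>
      card {q \<in> {..<length L}. sort_key L q < sort_key L p} < card (red_positions w))"
    unfolding cardS using L by (auto simp: red_positions_def sort_rank_conv_sort_key)
  also have "\<dots> \<longleftrightarrow> (\<exists>p\<in>red_positions w. \<forall>q\<in>{..<length L} - {p}.
      q \<in> red_positions w \<longleftrightarrow> sort_key L q < sort_key L p)"
  proof (rule initial_segment_iff_greatest[OF _ inj_on_sort_key])
    show "red_positions w \<noteq> {}"
      using cardS R(2) by auto
  qed (auto simp: red_positions_def L)
  also have "\<dots> \<longleftrightarrow> (\<exists>p\<in>red_positions w. last_red_at w L p)"
    using L by (intro bex_cong refl) (auto simp: red_positions_def last_red_at_def sort_key_less_iff)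
  finally show ?thesis .
qed

text \<open>Two such positions would each have to precede the other in the stable sort.\<close>

lemma last_red_at_unique:
  assumes "last_red_at w L p" "last_red_at w L p'" "p \<in> red_positions w" "p' \<in> red_positions w"
  shows "p = p'"
proof (rule ccontr)
  assume "p \<noteq> p'"
  with assms have "L ! p' < L ! p \<or> L ! p' = L ! p \<and> p' < p"
    and "L ! p < L ! p' \<or> L ! p = L ! p' \<and> p < p'"
    unfolding last_red_at_def red_positions_def by blast+
  then show False by auto
qed

section \<open>Counting the words with a given lowest red card\<close>

text \<open>The position \<open>p\<close> splits the deck into the part above and the part below it, and in each part the
  factors are constant on each colour.\<close>

lemma prod_by_colour_and_side:
  fixes x y z u :: "'a :: comm_monoid_mult"
  assumes "p < length w" "w ! p = Red"
  shows "(\<Prod>q<length w. if q = p then 1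
      else if w ! q = Red then (if q < p then x else y) else (if q < p then z else u)) =
    x ^ count_list (take p w) Red * y ^ (count_list w Red - Suc (count_list (take p w) Red)) *
    z ^ count_list (take p w) Black * u ^ (count_list w Black - count_list (take p w) Black)"
proof -
  define v where "v = drop (Suc p) w"
  have w: "w = take p w @ Red # v"
    using assms id_take_nth_drop[of p w] by (simp add: v_def)
  have count_w: "count_list w c = count_list (take p w @ Red # v) c" for c
    by (rule arg_cong[OF w])
  have len: "length w = p + Suc (length v)" 
    using assms by (simp add: v_def)
  let ?f = "\<lambda>q. if q = p then 1
      else if w ! q = Red then (if q < p then x else y) else (if q < p then z else u)"
  have count: "(\<Prod>q<length v. if v ! q = Red then s else t) =
      s ^ count_list v Red * t ^ count_list v Black" for s t :: 'a and v
  proof (induction v rule: rev_induct)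
    case (snoc c v)
    have "(\<Prod>q<length (v @ [c]). if (v @ [c]) ! q = Red then s else t) =
        (\<Prod>q<length v. if v ! q = Red then s else t) * (if c = Red then s else t)"
      by (simp add: nth_append)
    then show ?case
      using snoc by (cases c) (auto simp: mult_ac)
  qed simp
  have "prod ?f {..<length w} = prod ?f {..<p} * prod ?f {p..<length w}"
    using assms(1) by (subst prod.union_disjoint [symmetric]) (auto intro!: prod.cong)
  also have "prod ?f {p..<length w} = prod ?f {Suc p..<length w}"
    using assms(1) by (simp add: prod.atLeast_Suc_lessThan)
  also have "prod ?f {Suc p..<length w} = (\<Prod>q<length v. ?f (q + Suc p))"
    using prod.shift_bounds_nat_ivl[of ?f 0 "Suc p" "length v"] len
    by (simp add: atLeast0LessThan add.commute)
  also have "\<dots> = (\<Prod>q<length v. if v ! q = Red then y else u)"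
    using assms(1) by (intro prod.cong) (auto simp: v_def add.commute)
  also have "\<dots> = y ^ count_list v Red * u ^ count_list v Black"
    by (rule count)
  also have "prod ?f {..<p} = (\<Prod>q<length (take p w). if take p w ! q = Red then x else z)"
    using assms(1) by (intro prod.cong) auto
  also have "\<dots> = x ^ count_list (take p w) Red * z ^ count_list (take p w) Black"
    by (rule count)
  also have "count_list v Red = count_list w Red - Suc (count_list (take p w) Red)"
    using count_w[of Red] by simp
  also have "count_list v Black = count_list w Black - count_list (take p w) Black"
    using count_w[of Black] by simp
  finally show ?thesis
    by (simp only: mult_ac)
qed

text \<open>Once the label at \<open>p\<close> is fixed to \<open>k\<close>, the condition on the word is a separate condition on each
  letter: the label at \<open>q\<close> ranges over the set \<open>A q\<close> in the proof. Which of the bounds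
  are strict depends on the side of \<open>p\<close> because ties in the sort are resolved by position.\<close>

lemma card_last_red_at:
  assumes p: "p < length w" "w ! p = Red" and k: "k < a"
  shows "card {L. length L = length w \<and> set L \<subseteq> {..<a} \<and> L ! p = k \<and> last_red_at w L p} =
    (k + 1) ^ count_list (take p w) Red * k ^ (count_list w Red - Suc (count_list (take p w) Red)) *
    (a - (k + 1)) ^ count_list (take p w) Black *
    (a - k) ^ (count_list w Black - count_list (take p w) Black)"
proof -
  define A where "A = (\<lambda>q. if q = p then {k}
      else if w ! q = Red then (if q < p then {..k} else {..<k})
      else (if q < p then {k<..<a} else {k..<a}))"
  have "{L. length L = length w \<and> set L \<subseteq> {..<a} \<and> L ! p = k \<and> last_red_at w L p} =
      {L. length L = length w \<and> (\<forall>q<length w. L ! q \<in> A q)}" (is "?X = ?Y")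
  proof (rule set_eqI)
    fix L
    show "L \<in> ?X \<longleftrightarrow> L \<in> ?Y"
    proof (cases "length L = length w \<and> L ! p = k")
      case True
      have "set L \<subseteq> {..<a} \<longleftrightarrow> (\<forall>q<length w. L ! q < a)"
        using True by (auto simp: set_conv_nth)
      then have "L \<in> ?X \<longleftrightarrow> (\<forall>q<length w. L ! q < a \<and>
          (q \<noteq> p \<longrightarrow> (w ! q = Red \<longleftrightarrow> L ! q < k \<or> L ! q = k \<and> q < p)))"
        using True unfolding last_red_at_def by auto
      also have "\<dots> \<longleftrightarrow> (\<forall>q<length w. L ! q \<in> A q)"
      proof (intro all_cong1 imp_cong refl)
        fix q
        show "(L ! q < a \<and> (q \<noteq> p \<longrightarrow> (w ! q = Red \<longleftrightarrow> L ! q < k \<or> L ! q = k \<and> q < p)))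
            \<longleftrightarrow> L ! q \<in> A q"
          using True k by (auto simp: A_def)
      qed
      finally show ?thesis
        using True by simp
    next
      case False
      have "L ! p = k" if "L \<in> ?Y"
      proof -
        have "L ! p \<in> A p"
          using that p(1) by blast
        then show ?thesis
          by (simp add: A_def)
      qed
      with False show ?thesis
        by blast
    qed
  qed
  then have "card ?X = (\<Prod>q<length w. card (A q))"
    using card_lists_nth_in[of "length w" A] by simp
  also have "\<dots> = (\<Prod>q<length w. if q = p then 1
      else if w ! q = Red then (if q < p then k + 1 else k)
      else (if q < p then a - (k + 1) else a - k))"
    by (intro prod.cong) (auto simp: A_def)
  finally show ?thesis
    unfolding prod_by_colour_and_side[OF p] .
qed

text \<open>\<open>red_position w\<close> enumerates the red positions increasingly, so the red cards above the \<open>j\<close>-th one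
  are the \<open>j - 1\<close> previous entries of this enumeration.\<close>

lemma bij_betw_red_position:
  "bij_betw (red_position w) {1..count_list w Red} (red_positions w)"
  and count_reds_above_red_position:
  "j \<in> {1..count_list w Red} \<Longrightarrow> count_list (take (red_position w j) w) Red = j - 1"
proof -
  let ?xs = "filter (\<lambda>i. w ! i = Red) [0..<length w]"
  have set: "set ?xs = red_positions w"
    by (auto simp: red_positions_def)
  have dist: "distinct ?xs"
    by simp
  have len: "length ?xs = count_list w Red"
    using distinct_card[OF dist] unfolding set
    by (simp add: red_positions_def count_list_conv_card)
  have sorted: "sorted_wrt (<) ?xs"
    by (intro sorted_wrt_filter) simp
  have "bij_betw (\<lambda>i. ?xs ! i) {..<length ?xs} (red_positions w)"
    by (rule bij_betw_nth[OF dist refl set [symmetric]])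
  moreover have "bij_betw (\<lambda>j. j - 1) {1..count_list w Red} {..<length ?xs}"
    unfolding len by (rule bij_betwI[where g = Suc]) auto
  ultimately have "bij_betw ((\<lambda>i. ?xs ! i) \<circ> (\<lambda>j. j - 1)) {1..count_list w Red} (red_positions w)"
    by (rule bij_betw_trans[rotated])
  then show "bij_betw (red_position w) {1..count_list w Red} (red_positions w)"
    by (simp add: o_def red_position_def [abs_def])
  assume j: "j \<in> {1..count_list w Red}"
  let ?p = "?xs ! (j - 1)"
  have j': "j - 1 < length ?xs"
    using j len by auto
  have p: "?p < length w"
    using nth_mem[OF j'] by simp
  have "{i. i < length (take ?p w) \<and> take ?p w ! i = Red} = {i \<in> set ?xs. i < ?p}"
    using p by auto
  also have "\<dots> = (\<lambda>i. ?xs ! i) ` {..<j - 1}"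
  proof (intro equalityI subsetI)
    fix q assume "q \<in> {i \<in> set ?xs. i < ?p}"
    then obtain i where i: "i < length ?xs" "q = ?xs ! i" "?xs ! i < ?p"
      by (auto simp: in_set_conv_nth simp del: set_filter)
    then have "i < j - 1"
      using sorted_wrt_nth_less[OF sorted, of "j - 1" i] by (cases i "j - 1" rule: linorder_cases) auto
    with i show "q \<in> (\<lambda>i. ?xs ! i) ` {..<j - 1}"
      by blast
  next
    fix q assume "q \<in> (\<lambda>i. ?xs ! i) ` {..<j - 1}"
    then obtain i where i: "i < j - 1" "q = ?xs ! i"
      by blast
    then show "q \<in> {i \<in> set ?xs. i < ?p}"
      using sorted_wrt_nth_less[OF sorted i(1) j'] nth_mem[of i ?xs] j' by simp
  qed
  finally have "count_list (take ?p w) Red = card ((\<lambda>i. ?xs ! i) ` {..<j - 1})"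
    by (simp only: count_list_conv_card)
  also have "\<dots> = j - 1"
    using inj_on_nth[OF dist, of "{..<j - 1}"] j' by (subst card_image) auto
  finally show "count_list (take (red_position w j) w) Red = j - 1"
    by (simp add: red_position_def)
qed

theorem theorem3p1:
  fixes R B a :: nat and w :: "colour list"
  assumes "R \<ge> 1" and "B \<ge> 1" and "a \<ge> 1"
    and "count_list w Red = R" and "count_list w Black = B"
  shows "pmf (shuffle a (red_black_deck R B)) w =
    1 / real a ^ (R + B) *
      (\<Sum>k = 1..a. \<Sum>j = 1..R.
         real (k - 1) ^ (R - j) * real k ^ (j - 1) *
         real (a - k) ^ blacks_above w j *
         real (a - k + 1) ^ (B - blacks_above w j))"
proof -
  let ?words = "{L. length L = length w \<and> set L \<subseteq> {..<a}}"
  let ?X = "\<lambda>p k. {L. length L = length w \<and> set L \<subseteq> {..<a} \<and> L ! p = k \<and> last_red_at w L p}"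
  let ?t = "\<lambda>k j. k ^ (R - j) * (k + 1) ^ (j - 1) * (a - (k + 1)) ^ blacks_above w j *
      (a - k) ^ (B - blacks_above w j)"
  have len: "length (red_black_deck R B) = length w"
    using length_eq_count_colours[of w] assms by (simp add: red_black_deck_def)
  have fin: "finite (?X p k)" for p k
    by (rule finite_subset[OF _ finite_lists_length_eq[of "{..<a}" "length w"]]) auto
  have "{L. length L = length w \<and> set L \<subseteq> {..<a} \<and>
      map (\<lambda>p. red_black_deck R B ! sort_rank L p) [0..<length w] = w} =
      {L \<in> ?words. \<exists>p\<in>red_positions w. last_red_at w L p}"
    using sorts_to_red_black_iff[of w R B] assms by auto
  \<comment> \<open>The lowest red card of the original deck lands on a unique position \<open>p\<close>, with a unique
    label \<open>k\<close>.\<close>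
  also have "\<dots> = (\<Union>(p, k)\<in>red_positions w \<times> {..<a}. ?X p k)" (is "?W = ?U")
  proof (intro equalityI subsetI)
    fix L assume "L \<in> ?W"
    then obtain p where L: "L \<in> ?words" and p: "p \<in> red_positions w" "last_red_at w L p"
      by blast
    have "L ! p \<in> set L"
      using L p(1) by (intro nth_mem) (auto simp: red_positions_def)
    with L have "L ! p \<in> {..<a}"
      by blast
    with L p show "L \<in> ?U"
      by blast
  qed auto
  also have "card \<dots> =
      (\<Sum>x\<in>red_positions w \<times> {..<a}. card (case x of (p, k) \<Rightarrow> ?X p k))"
  proof (rule card_UN_disjoint)
    show "finite (red_positions w \<times> {..<a})"
      by (simp add: red_positions_def)
    show "\<forall>x\<in>red_positions w \<times> {..<a}. finite (case x of (p, k) \<Rightarrow> ?X p k)"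
      using fin by auto
    have "p = p' \<and> k = k'"
      if "p \<in> red_positions w" "p' \<in> red_positions w" "L \<in> ?X p k" "L \<in> ?X p' k'" for p p' k k' L
      using that last_red_at_unique[of w L p p'] by auto
    then show "\<forall>x\<in>red_positions w \<times> {..<a}. \<forall>y\<in>red_positions w \<times> {..<a}. x \<noteq> y \<longrightarrow>
        (case x of (p, k) \<Rightarrow> ?X p k) \<inter> (case y of (p, k) \<Rightarrow> ?X p k) = {}"
      by blast
  qed
  also have "\<dots> = (\<Sum>(p, k)\<in>red_positions w \<times> {..<a}. card (?X p k))"
    by (intro sum.cong) auto
  also have "\<dots> = (\<Sum>p\<in>red_positions w. \<Sum>k<a. card (?X p k))"
    by (simp add: sum.cartesian_product)
  also have "\<dots> = (\<Sum>j = 1..R. \<Sum>k<a. card (?X (red_position w j) k))"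
    unfolding assms(4) [symmetric] by (rule sum.reindex_bij_betw [OF bij_betw_red_position, symmetric])
  also have "\<dots> = (\<Sum>j = 1..R. \<Sum>k<a. ?t k j)"
  proof (intro sum.cong refl)
    fix j k assume j: "j \<in> {1..R}" and k: "k \<in> {..<a}"
    let ?p = "red_position w j"
    have "?p \<in> red_positions w"
      using bij_betw_apply[OF bij_betw_red_position[of w]] j assms by simp
    then have p: "?p < length w" "w ! ?p = Red"
      by (auto simp: red_positions_def)
    have "count_list (take ?p w) Red = j - 1"
      using count_reds_above_red_position[of j w] j assms by simp
    moreover have "R - Suc (j - 1) = R - j"
      using j by simp
    ultimately show "card (?X ?p k) = ?t k j"
      using card_last_red_at[OF p, of k a] k assms by (simp add: blacks_above_def mult_ac)
  qed
  also have "\<dots> = (\<Sum>k<a. \<Sum>j = 1..R. ?t k j)"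
    by (rule sum.swap)
  also have "\<dots> = (\<Sum>k = 1..a. \<Sum>j = 1..R. ?t (k - 1) j)"
    by (rule sum.reindex_bij_witness[of _ "\<lambda>k. k - 1" Suc]) auto
  also have "\<dots> = (\<Sum>k = 1..a. \<Sum>j = 1..R. (k - 1) ^ (R - j) * k ^ (j - 1) *
      (a - k) ^ blacks_above w j * (a - k + 1) ^ (B - blacks_above w j))"
    by (intro sum.cong refl) (auto simp: Suc_diff_le)
  finally show ?thesis
    using pmf_shuffle[OF \<open>a \<ge> 1\<close>, of "red_black_deck R B" w] assms length_eq_count_colours[of w]
    by (simp add: len)
qed

end
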